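(* Let $A$ be a mp-ring and let $\gamma:\operatorname{Spec}(A)\rightarrow\operatorname{Min}(A)$ be the retraction map which sends each prime ideal $\mathfrak{p}$ of $A$ to the unique minimal prime ideal of $A$ contained in $\mathfrak{p}$. Then $\gamma$ is Zariski continuous if and only if $\operatorname{Min}(A)$ is Zariski compact.
   Context: All rings are commutative (with unit). A ring $A$ is a mp-ring if each prime ideal of $A$ contains a unique minimal prime ideal of $A$. $\operatorname{Min}(A)$ is the set of minimal prime ideals of $A$. "Zariski continuous" and "Zariski compact" refer to the Zariski topology on $\operatorname{Spec}(A)$ and the topology it induces on $\operatorname{Min}(A)$. Compact means quasi-compact and Hausdorff. *)

theory Defs
  imports "HOL-Algebra.Ideal" "HOL-Analysis.Analysis"
begin

definition Spec :: "('a, 'b) ring_scheme \<Rightarrow> 'a set set" where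
  "Spec A = {P. primeideal P A}"

definition min_primes :: "('a, 'b) ring_scheme \<Rightarrow> 'a set set" where
  "min_primes A = {M \<in> Spec A. \<forall>Q \<in> Spec A. Q \<subseteq> M \<longrightarrow> Q = M}"

text \<open>The zero ring is a commutative ring in this sense; its spectrum is empty.\<close>

definition mp_ring :: "('a, 'b) ring_scheme \<Rightarrow> bool" where
  "mp_ring A \<longleftrightarrow> cring A \<and> (\<forall>P \<in> Spec A. \<exists>!M. M \<in> min_primes A \<and> M \<subseteq> P)"

definition vanishing_set :: "('a, 'b) ring_scheme \<Rightarrow> 'a set \<Rightarrow> 'a set set" where
  "vanishing_set A E = {P \<in> Spec A. E \<subseteq> P}"

definition zariski :: "('a, 'b) ring_scheme \<Rightarrow> 'a set topology" where
  "zariski A = topology (\<lambda>U. \<exists>E \<subseteq> carrier A. U = Spec A - vanishing_set A E)"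

definition min_zariski :: "('a, 'b) ring_scheme \<Rightarrow> 'a set topology" where
  "min_zariski A = subtopology (zariski A) (min_primes A)"

text \<open>Outside the spectrum of an mp-ring the value is irrelevant.\<close>

definition min_retraction :: "('a, 'b) ring_scheme \<Rightarrow> 'a set \<Rightarrow> 'a set" where
  "min_retraction A P = (THE M. M \<in> min_primes A \<and> M \<subseteq> P)"

lemma istopology_zariski:
  "istopology (\<lambda>U. \<exists>E \<subseteq> carrier A. U = Spec A - vanishing_set A E)"
  unfolding istopology_def
proof (intro conjI allI impI)
  fix S T
  assume "\<exists>E \<subseteq> carrier A. S = Spec A - vanishing_set A E"
    and "\<exists>E \<subseteq> carrier A. T = Spec A - vanishing_set A E"
  then obtain E F where E: "E \<subseteq> carrier A" "S = Spec A - vanishing_set A E"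
    and F: "F \<subseteq> carrier A" "T = Spec A - vanishing_set A F"
    by blast
  show "\<exists>G \<subseteq> carrier A. S \<inter> T = Spec A - vanishing_set A G"
  proof (cases "Spec A = {}")
    case True
    then show ?thesis using E F by auto
  next
    case False
    then obtain P0 where "primeideal P0 A" by (auto simp: Spec_def)
    then interpret cring A by (simp add: primeideal_def)
    let ?G = "{a \<otimes>\<^bsub>A\<^esub> b | a b. a \<in> E \<and> b \<in> F}"
    have *: "?G \<subseteq> P \<longleftrightarrow> E \<subseteq> P \<or> F \<subseteq> P" if "P \<in> Spec A" for P
    proof -
      interpret P: primeideal P A using that by (simp add: Spec_def)
      have "?G \<subseteq> P" if "E \<subseteq> P \<or> F \<subseteq> P"
        using that E(1) F(1) P.I_l_closed P.I_r_closed by blast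
      moreover have "E \<subseteq> P \<or> F \<subseteq> P" if "?G \<subseteq> P"
      proof (rule ccontr)
        assume "\<not> (E \<subseteq> P \<or> F \<subseteq> P)"
        then obtain a b where "a \<in> E" "a \<notin> P" "b \<in> F" "b \<notin> P" by blast
        moreover have "a \<otimes>\<^bsub>A\<^esub> b \<in> P" using that \<open>a \<in> E\<close> \<open>b \<in> F\<close> by blast
        ultimately show False using P.I_prime[of a b] E(1) F(1) by blast
      qed
      ultimately show ?thesis by blast
    qed
    have "?G \<subseteq> carrier A" using E(1) F(1) by blast
    moreover have "S \<inter> T = Spec A - vanishing_set A ?G"
      using * unfolding E(2) F(2) vanishing_set_def by blast
    ultimately show ?thesis by blast
  qed
next
  fix K
  assume "\<forall>U\<in>K. \<exists>E \<subseteq> carrier A. U = Spec A - vanishing_set A E"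
  then obtain E where E: "\<And>U. U \<in> K \<Longrightarrow> E U \<subseteq> carrier A \<and> U = Spec A - vanishing_set A (E U)"
    by metis
  have "(\<Union>U\<in>K. E U) \<subseteq> carrier A" using E by blast
  moreover have "\<Union>K = (\<Union>U\<in>K. Spec A - vanishing_set A (E U))"
    using E by auto
  then have "\<Union>K = Spec A - vanishing_set A (\<Union>U\<in>K. E U)"
    by (auto simp: vanishing_set_def)
  ultimately show "\<exists>F \<subseteq> carrier A. \<Union>K = Spec A - vanishing_set A F" by blast
qed

lemma openin_zariski:
  "openin (zariski A) U \<longleftrightarrow> (\<exists>E \<subseteq> carrier A. U = Spec A - vanishing_set A E)"
  unfolding zariski_def by (simp add: topology_inverse'[OF istopology_zariski])

lemma topspace_zariski: "topspace (zariski A) = Spec A"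
proof
  show "topspace (zariski A) \<subseteq> Spec A"
    unfolding topspace_def openin_zariski by blast
  have "Spec A = Spec A - vanishing_set A (carrier A)"
  proof -
    have "P \<noteq> carrier A" and "P \<subseteq> carrier A" if "P \<in> Spec A" for P
    proof -
      interpret P: primeideal P A using that by (simp add: Spec_def)
      show "P \<noteq> carrier A" "P \<subseteq> carrier A"
        using P.I_notcarr P.a_subset by auto
    qed
    then show ?thesis by (auto simp: vanishing_set_def)
  qed
  then have "openin (zariski A) (Spec A)" unfolding openin_zariski by blast
  then show "Spec A \<subseteq> topspace (zariski A)" by (rule openin_subset)
qed

lemma topspace_min_zariski: "topspace (min_zariski A) = min_primes A"
  by (auto simp: min_zariski_def topspace_zariski min_primes_def)

lemma min_retraction:
  assumes "mp_ring A" "P \<in> Spec A"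
  shows "min_retraction A P \<in> min_primes A" "min_retraction A P \<subseteq> P"
  using theI'[of "\<lambda>M. M \<in> min_primes A \<and> M \<subseteq> P"] assms
  unfolding mp_ring_def min_retraction_def by auto

lemma min_retraction_min_primes:
  assumes "mp_ring A" "M \<in> min_primes A"
  shows "min_retraction A M = M"
  using assms min_retraction[of A M] by (auto simp: min_primes_def)

end

theory Submission
  imports Defs "HOL-Algebra.Ring_Divisibility"
begin

text \<open>
  If \<open>\<gamma>\<close> is continuous, then \<open>Min(A)\<close> is the continuous image of the quasi-compact space
  \<open>Spec(A)\<close>, hence quasi-compact. It is also Hausdorff, which holds in every commutative ring:
  an element \<open>m\<close> of a minimal prime \<open>M\<close> is nilpotent in the localization at \<open>M\<close>, so that
  \<open>t m\<^sup>n = 0\<close> for some \<open>t \<notin> M\<close>, and therefore the basic open sets \<open>D(m)\<close> and \<open>D(t)\<close> of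
  \<open>Spec(A)\<close> are disjoint. Thus \<open>M\<close> can be separated by open sets of \<open>Spec(A)\<close> from every prime
  \<open>P\<close> that does not contain it (\<open>zariski_separates_min_prime\<close>).

  The same separation proves the converse. Let \<open>P\<close> be a prime and \<open>C\<close> a closed set of minimal
  primes with \<open>\<gamma>(P) \<notin> C\<close>. As \<open>A\<close> is a mp-ring, \<open>P\<close> contains no member of \<open>C\<close>, so \<open>P\<close> can be
  separated from each of them. When \<open>Min(A)\<close> is quasi-compact, so is \<open>C\<close>, and finitely many of
  these separations give disjoint open sets \<open>N\<close> and \<open>W\<close> with \<open>P \<in> N\<close> and \<open>C \<subseteq> W\<close>. Zariski open
  sets are stable under passing to smaller primes, so \<open>\<gamma>\<close> maps \<open>N\<close> into itself and hence avoids
  \<open>C\<close> on \<open>N\<close>.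
\<close>

section \<open>Prime ideals avoiding a multiplicative set\<close>

text \<open>
  Krull's argument: an ideal \<open>P\<close> that is maximal among those disjoint from \<open>S\<close> is prime. If \<open>a\<close>
  and \<open>b\<close> lie outside \<open>P\<close>, then both \<open>P + (a)\<close> and \<open>P + (b)\<close> meet \<open>S\<close>, and multiplying two such
  elements of \<open>S\<close> would give an element of \<open>P\<close> if \<open>a b\<close> were in \<open>P\<close>.
\<close>

lemma (in cring) exists_primeideal_disjoint:
  assumes "ideal I R" and one: "\<one> \<in> S"
    and mult: "\<And>x y. x \<in> S \<Longrightarrow> y \<in> S \<Longrightarrow> x \<otimes> y \<in> S"
    and "I \<inter> S = {}"
  shows "\<exists>P. primeideal P R \<and> I \<subseteq> P \<and> P \<inter> S = {}"
proof -
  let ?F = "{J. ideal J R \<and> I \<subseteq> J \<and> J \<inter> S = {}}"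
  have "\<exists>P\<in>?F. \<forall>X\<in>?F. P \<subseteq> X \<longrightarrow> X = P"
  proof (rule subset_Zorn_nonempty)
    show "?F \<noteq> {}" using assms by blast
  next
    fix C assume C: "C \<noteq> {}" "subset.chain ?F C"
    have "subset.chain {J. ideal J R} C"
      using C(2) by (auto simp: pred_on.chain_def)
    from chain_Union_is_ideal[OF this] have "ideal (\<Union>C) R" using C(1) by simp
    moreover have "C \<subseteq> ?F" using C(2) by (simp add: pred_on.chain_def)
    then have "I \<subseteq> \<Union>C" "\<Union>C \<inter> S = {}" using C(1) by blast+
    ultimately show "\<Union>C \<in> ?F" by simp
  qed
  then obtain P where P: "ideal P R" "I \<subseteq> P" "P \<inter> S = {}"
    and max: "\<And>X. ideal X R \<Longrightarrow> X \<inter> S = {} \<Longrightarrow> P \<subseteq> X \<Longrightarrow> X = P"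
    by (smt (verit) mem_Collect_eq subset_trans)
  interpret P: ideal P R by fact
  have meets: "\<exists>p\<in>P. \<exists>r\<in>carrier R. p \<oplus> r \<otimes> a \<in> S" if a: "a \<in> carrier R" "a \<notin> P" for a
  proof (rule ccontr)
    assume none: "\<not> ?thesis"
    have "(P <+> PIdl a) \<inter> S = {}"
      using none by (auto simp: set_add_def' cgenideal_def)
    moreover have "ideal (P <+> PIdl a) R"
      using add_ideals[OF P(1) cgenideal_ideal[OF a(1)]] .
    moreover have sub: "P \<union> PIdl a \<subseteq> P <+> PIdl a"
      using union_genideal[OF P(1) cgenideal_ideal[OF a(1)]]
        genideal_self[of "P \<union> PIdl a"] P.a_subset
        ideal.Icarr[OF cgenideal_ideal[OF a(1)]] by blast
    ultimately have "P <+> PIdl a = P" using max by blast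
    with sub a cgenideal_self show False by blast
  qed
  have "primeideal P R"
  proof (rule primeidealI[OF P(1) is_cring])
    show "carrier R \<noteq> P" using one P(3) by blast
  next
    fix a b assume ab: "a \<in> carrier R" "b \<in> carrier R" "a \<otimes> b \<in> P"
    show "a \<in> P \<or> b \<in> P"
    proof (rule ccontr)
      assume "\<not> ?thesis"
      then obtain p r q s where pr: "p \<in> P" "r \<in> carrier R" "p \<oplus> r \<otimes> a \<in> S"
        and qs: "q \<in> P" "s \<in> carrier R" "q \<oplus> s \<otimes> b \<in> S"
        using meets ab(1,2) by meson
      have pq: "p \<in> carrier R" "q \<in> carrier R" using pr(1) qs(1) P.Icarr by auto
      have "(p \<oplus> r \<otimes> a) \<otimes> (q \<oplus> s \<otimes> b)
          = p \<otimes> (q \<oplus> s \<otimes> b) \<oplus> ((r \<otimes> a) \<otimes> q \<oplus> (r \<otimes> s) \<otimes> (a \<otimes> b))"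
        using pq pr(2) qs(2) ab(1,2) by algebra
      also have "\<dots> \<in> P"
      proof (intro P.a_closed)
        show "p \<otimes> (q \<oplus> s \<otimes> b) \<in> P" using pr(1) pq(2) qs(2) ab(2) by (simp add: P.I_r_closed)
        show "(r \<otimes> a) \<otimes> q \<in> P" using qs(1) pr(2) ab(1) by (simp add: P.I_l_closed)
        show "(r \<otimes> s) \<otimes> (a \<otimes> b) \<in> P" using ab(3) pr(2) qs(2) by (simp add: P.I_l_closed)
      qed
      finally show False using mult[OF pr(3) qs(3)] P(3) by blast
    qed
  qed
  then show ?thesis using P by blast
qed

section \<open>Quasi-compactness of the spectrum\<close>

lemma (in ring) Idl_mono:
  assumes "T \<subseteq> carrier R" "S \<subseteq> T"
  shows "Idl S \<subseteq> Idl T"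
  using assms by (meson genideal_ideal genideal_minimal genideal_self subset_trans)

text \<open>
  The ideals generated by the finite subsets of \<open>E\<close> form a directed family, so their union is an
  ideal. It is the ideal generated by \<open>E\<close>, in a form that exhibits the finitely many generators
  behind each element.
\<close>

lemma (in ring) ideal_finitely_generated_members:
  assumes E: "E \<subseteq> carrier R"
  shows "ideal {x. \<exists>F. finite F \<and> F \<subseteq> E \<and> x \<in> Idl F} R"
proof -
  define J where "J = {x. \<exists>F. finite F \<and> F \<subseteq> E \<and> x \<in> Idl F}"
  have JI: "x \<in> J" if "finite F" "F \<subseteq> E" "x \<in> Idl F" for x F
    unfolding J_def using that by auto
  have JE: "\<exists>F. finite F \<and> F \<subseteq> E \<and> x \<in> Idl F" if "x \<in> J" for x
    using that unfolding J_def by simp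
  have id: "ideal (Idl F) R" if "F \<subseteq> E" for F
    using genideal_ideal[OF subset_trans[OF that E]] .
  have carr: "J \<subseteq> carrier R"
    using JE ideal.Icarr[OF id] by (metis subsetI)
  have zero: "\<zero> \<in> Idl {}"
    using additive_subgroup.zero_closed[OF ideal.axioms(1)[OF id[of "{}"]]] by simp
  have ne: "J \<noteq> {}" using JI[OF _ _ zero] by auto
  have minus: "\<ominus> a \<in> J" if a: "a \<in> J" for a
  proof -
    obtain F where F: "finite F" "F \<subseteq> E" "a \<in> Idl F" using JE[OF a] by auto
    then have "\<ominus> a \<in> Idl F"
      using additive_subgroup.a_inv_closed[OF ideal.axioms(1)[OF id]] by simp
    with F(1,2) show ?thesis by (rule JI)
  qed
  have plus: "a \<oplus> b \<in> J" if ab: "a \<in> J" "b \<in> J" for a b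
  proof -
    obtain F where F: "finite F" "F \<subseteq> E" "a \<in> Idl F" using JE[OF ab(1)] by auto
    obtain G where G: "finite G" "G \<subseteq> E" "b \<in> Idl G" using JE[OF ab(2)] by auto
    have FG: "finite (F \<union> G)" "F \<union> G \<subseteq> E" using F G by simp_all
    have "F \<union> G \<subseteq> carrier R" using FG(2) E by (rule subset_trans)
    then have "a \<in> Idl (F \<union> G)" "b \<in> Idl (F \<union> G)"
      using F(3) G(3) Idl_mono[of "F \<union> G" F] Idl_mono[of "F \<union> G" G] by auto
    then have "a \<oplus> b \<in> Idl (F \<union> G)"
      by (rule additive_subgroup.a_closed[OF ideal.axioms(1)[OF id[OF FG(2)]]])
    with FG show ?thesis by (rule JI)
  qed
  have mult: "x \<otimes> a \<in> J" "a \<otimes> x \<in> J" if "a \<in> J" and x: "x \<in> carrier R" for a x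
  proof -
    obtain F where F: "finite F" "F \<subseteq> E" "a \<in> Idl F" using JE[OF \<open>a \<in> J\<close>] by auto
    then have "x \<otimes> a \<in> Idl F" "a \<otimes> x \<in> Idl F"
      using x ideal.I_l_closed[OF id] ideal.I_r_closed[OF id] by simp_all
    then show "x \<otimes> a \<in> J" "a \<otimes> x \<in> J" using JI[OF F(1,2)] by simp_all
  qed
  have "subgroup J (add_monoid R)"
    using carr ne minus plus by (rule add.subgroupI)
  then have "ideal J R"
    using mult by (rule idealI[OF ring_axioms])
  then show ?thesis unfolding J_def .
qed

text \<open>
  A set lying in no prime ideal generates the unit ideal, and an expression of the unit involves
  only finitely many generators.
\<close>

lemma (in cring) finite_subset_in_no_primeideal:
  assumes E: "E \<subseteq> carrier R" and no: "\<And>P. primeideal P R \<Longrightarrow> \<not> E \<subseteq> P"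
  shows "\<exists>F. finite F \<and> F \<subseteq> E \<and> (\<forall>P. primeideal P R \<longrightarrow> \<not> F \<subseteq> P)"
proof -
  define J where "J = {x. \<exists>F. finite F \<and> F \<subseteq> E \<and> x \<in> Idl F}"
  have J: "ideal J R" unfolding J_def by (rule ideal_finitely_generated_members[OF E])
  have EJ: "E \<subseteq> J"
  proof
    fix e assume e: "e \<in> E"
    then have "e \<in> Idl {e}" using genideal_self' E by blast
    moreover have "finite {e}" "{e} \<subseteq> E" using e by simp_all
    ultimately show "e \<in> J" unfolding J_def by blast
  qed
  have "\<one> \<in> J"
  proof (rule ccontr)
    assume "\<one> \<notin> J"
    then obtain P where P: "primeideal P R" "J \<subseteq> P"
      using exists_primeideal_disjoint[OF J, of "{\<one>}"] by auto
    show False using no[OF P(1)] subset_trans[OF EJ P(2)] by contradiction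
  qed
  then obtain F where F: "finite F" "F \<subseteq> E" "\<one> \<in> Idl F" unfolding J_def by auto
  have "\<not> F \<subseteq> P" if "primeideal P R" for P
  proof
    interpret P: primeideal P R by fact
    assume "F \<subseteq> P"
    then have "\<one> \<in> P" using genideal_minimal[OF P.is_ideal] F(3) by blast
    then show False using P.one_imp_carrier P.I_notcarr by simp
  qed
  with F show ?thesis by metis
qed

lemma (in cring) compact_space_zariski: "compact_space (zariski R)"
  unfolding compact_space_alt
proof (intro allI impI, elim conjE)
  fix \<U> assume op: "\<forall>U\<in>\<U>. openin (zariski R) U" and cov: "topspace (zariski R) \<subseteq> \<Union>\<U>"
  obtain E where E: "\<And>U. U \<in> \<U> \<Longrightarrow> E U \<subseteq> carrier R \<and> U = Spec R - vanishing_set R (E U)"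
    using op unfolding openin_zariski by metis
  have "(\<Union>U\<in>\<U>. E U) \<subseteq> carrier R" using E by blast
  moreover have "\<not> (\<Union>U\<in>\<U>. E U) \<subseteq> P" if P: "primeideal P R" for P
  proof -
    have "P \<in> Spec R" using P by (simp add: Spec_def)
    then obtain U where "U \<in> \<U>" "P \<in> U" using cov unfolding topspace_zariski by blast
    then show ?thesis using E[of U] by (auto simp: vanishing_set_def)
  qed
  ultimately obtain F where F: "finite F" "F \<subseteq> (\<Union>U\<in>\<U>. E U)"
    and Fno: "\<forall>P. primeideal P R \<longrightarrow> \<not> F \<subseteq> P"
    using finite_subset_in_no_primeideal[of "\<Union>U\<in>\<U>. E U"] by meson
  obtain \<F> where \<F>: "finite \<F>" "\<F> \<subseteq> \<U>" "F \<subseteq> (\<Union>U\<in>\<F>. E U)"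
    using finite_subset_Union[of F "E ` \<U>"] F
    by (metis (no_types, lifting) finite_subset_image)
  have "topspace (zariski R) \<subseteq> \<Union>\<F>"
  proof
    fix P assume "P \<in> topspace (zariski R)"
    then have P: "P \<in> Spec R" by (simp add: topspace_zariski)
    then obtain f where "f \<in> F" "f \<notin> P" using Fno by (auto simp: Spec_def)
    then obtain U where "U \<in> \<F>" "f \<in> E U" using \<F>(3) by blast
    then have "P \<in> U" using E[of U] \<F>(2) P \<open>f \<notin> P\<close> by (auto simp: vanishing_set_def)
    then show "P \<in> \<Union>\<F>" using \<open>U \<in> \<F>\<close> by blast
  qed
  then show "\<exists>\<F>. finite \<F> \<and> \<F> \<subseteq> \<U> \<and> topspace (zariski R) \<subseteq> \<Union>\<F>" using \<F> by blast
qed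

section \<open>Separating minimal primes from other primes\<close>

lemma openin_zariski_basic:
  assumes "a \<in> carrier A"
  shows "openin (zariski A) {P \<in> Spec A. a \<notin> P}"
  unfolding openin_zariski
  using assms by (intro exI[of _ "{a}"]) (auto simp: vanishing_set_def)

text \<open>
  This is what makes the retraction \<open>\<gamma>\<close> map every Zariski open set into itself.
\<close>

lemma openin_zariski_downward:
  assumes "openin (zariski A) U" "P \<in> U" "Q \<in> Spec A" "Q \<subseteq> P"
  shows "Q \<in> U"
  using assms unfolding openin_zariski vanishing_set_def by auto

text \<open>
  Elements of a minimal prime \<open>M\<close> become nilpotent in the localization at \<open>M\<close>. Otherwise the
  products \<open>t m\<^sup>n\<close> with \<open>t \<notin> M\<close> form a multiplicative set without zero, and a prime avoiding it
  would lie strictly below \<open>M\<close>.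
\<close>

lemma min_prime_locally_nilpotent:
  fixes A (structure)
  assumes M: "M \<in> min_primes A" and m: "m \<in> M"
  obtains t and n :: nat where "t \<in> carrier A" "t \<notin> M" "t \<otimes> m [^] n = \<zero>"
proof -
  interpret M: primeideal M A using M by (simp add: min_primes_def Spec_def)
  have mc: "m \<in> carrier A" using m M.Icarr by blast
  let ?S = "{t \<otimes> m [^] n | t (n::nat). t \<in> carrier A - M}"
  have one: "\<one> \<in> carrier A - M" using M.one_imp_carrier M.I_notcarr by blast
  have "\<zero> \<in> ?S"
  proof (rule ccontr)
    assume nz: "\<zero> \<notin> ?S"
    have pow_in: "m [^] n \<in> ?S" for n :: nat
    proof -
      have "m [^] n = \<one> \<otimes> m [^] n" using mc by simp
      then show ?thesis using one by blast
    qed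
    have mult: "x \<otimes> y \<in> ?S" if "x \<in> ?S" "y \<in> ?S" for x y
    proof -
      from that obtain t u and k l :: nat
        where t: "t \<in> carrier A" "t \<notin> M" "x = t \<otimes> m [^] k"
          and u: "u \<in> carrier A" "u \<notin> M" "y = u \<otimes> m [^] l" by blast
      have "x \<otimes> y = (t \<otimes> u) \<otimes> (m [^] k \<otimes> m [^] l)"
        using t u mc M.nat_pow_closed[OF mc] by (simp add: M.m_ac)
      then have "x \<otimes> y = (t \<otimes> u) \<otimes> m [^] (k + l)"
        using mc by (simp add: M.nat_pow_mult)
      moreover have "t \<otimes> u \<in> carrier A - M" using t u M.I_prime by blast
      ultimately show ?thesis by blast
    qed
    have "\<one> \<in> ?S" using pow_in[of 0] by simp
    moreover have "{\<zero>} \<inter> ?S = {}" using nz by blast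
    ultimately obtain Q where Q: "primeideal Q A" "Q \<inter> ?S = {}"
      using M.exists_primeideal_disjoint[OF M.zeroideal, of ?S, OF _ mult] by blast
    interpret Q: primeideal Q A by (rule Q(1))
    have "Q \<subseteq> M"
    proof
      fix x assume x: "x \<in> Q"
      then have xc: "x \<in> carrier A" by (rule Q.Icarr)
      show "x \<in> M"
      proof (rule ccontr)
        assume "x \<notin> M"
        then have "x \<otimes> m [^] (0::nat) \<in> ?S" using xc by blast
        then show False using x xc Q(2) by auto
      qed
    qed
    then have "Q = M" using M Q(1) by (auto simp: min_primes_def Spec_def)
    moreover have "m \<in> ?S" using pow_in[of 1] mc by simp
    ultimately show False using m Q(2) by blast
  qed
  then show thesis using that by force
qed

text \<open>
  For \<open>m\<close> in \<open>M\<close> but not in \<open>P\<close>, choose \<open>t \<notin> M\<close> with \<open>t m\<^sup>n = 0\<close>. Every prime contains \<open>0\<close>, hence \<open>t\<close>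
  or \<open>m\<close>, so \<open>D(m)\<close> and \<open>D(t)\<close> are the required neighbourhoods.
\<close>

lemma zariski_separates_min_prime:
  fixes A (structure)
  assumes M: "M \<in> min_primes A" and P: "P \<in> Spec A" and "\<not> M \<subseteq> P"
  obtains U V where "openin (zariski A) U" "openin (zariski A) V" "P \<in> U" "M \<in> V" "U \<inter> V = {}"
proof -
  obtain m where m: "m \<in> M" "m \<notin> P" using assms(3) by blast
  have MS: "M \<in> Spec A" using M by (simp add: min_primes_def)
  interpret M: primeideal M A using MS by (simp add: Spec_def)
  have mc: "m \<in> carrier A" using m(1) M.Icarr by blast
  obtain t and n :: nat where t: "t \<in> carrier A" "t \<notin> M" "t \<otimes> m [^] n = \<zero>"
    using min_prime_locally_nilpotent[OF M m(1)] .
  have "m \<in> Q \<or> t \<in> Q" if "Q \<in> Spec A" for Q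
  proof -
    interpret Q: primeideal Q A using that by (simp add: Spec_def)
    have pow: "m \<in> Q" if "m [^] k \<in> Q" for k :: nat
      using that
    proof (induction k)
      case 0
      then show ?case using Q.one_imp_carrier Q.I_notcarr by simp
    next
      case (Suc k)
      then show ?case using Q.I_prime[of "m [^] k" m] mc by auto
    qed
    have "t \<otimes> m [^] n \<in> Q" using t(3) Q.zero_closed by simp
    then show ?thesis using Q.I_prime[of t "m [^] n"] t(1) mc pow by auto
  qed
  then have "{Q \<in> Spec A. m \<notin> Q} \<inter> {Q \<in> Spec A. t \<notin> Q} = {}" by blast
  then show thesis
    using that openin_zariski_basic[OF mc] openin_zariski_basic[OF t(1)] P MS m(2) t(2) by blast
qed

lemma Hausdorff_space_min_zariski: "Hausdorff_space (min_zariski A)"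
  unfolding Hausdorff_space_def topspace_min_zariski
proof (intro allI impI, elim conjE)
  fix P M assume P: "P \<in> min_primes A" and M: "M \<in> min_primes A" and "P \<noteq> M"
  then have "P \<in> Spec A" "\<not> M \<subseteq> P" by (auto simp: min_primes_def)
  then obtain U V where UV: "openin (zariski A) U" "openin (zariski A) V" "P \<in> U" "M \<in> V"
    "U \<inter> V = {}"
    using zariski_separates_min_prime[OF M] by blast
  have "openin (min_zariski A) (min_primes A \<inter> U)" "openin (min_zariski A) (min_primes A \<inter> V)"
    unfolding min_zariski_def using UV by (simp_all add: openin_subtopology_Int2)
  moreover have "P \<in> min_primes A \<inter> U" "M \<in> min_primes A \<inter> V" using UV P M by simp_all
  moreover have "disjnt (min_primes A \<inter> U) (min_primes A \<inter> V)"
    using UV(5) by (auto simp: disjnt_def)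
  ultimately show "\<exists>U V. openin (min_zariski A) U \<and> openin (min_zariski A) V
      \<and> P \<in> U \<and> M \<in> V \<and> disjnt U V" by blast
qed

section \<open>Continuity of the retraction\<close>

text \<open>
  Quasi-compactness upgrades the separation of \<open>P\<close> from single minimal primes to the separation
  from a whole quasi-compact set of them.
\<close>

lemma zariski_separates_compact_min_primes:
  assumes C: "compactin (zariski A) C" "C \<subseteq> min_primes A"
    and P: "P \<in> Spec A" and nle: "\<And>M. M \<in> C \<Longrightarrow> \<not> M \<subseteq> P"
  obtains N W where "openin (zariski A) N" "openin (zariski A) W" "P \<in> N" "C \<subseteq> W" "N \<inter> W = {}"
proof -
  have "\<exists>U V. openin (zariski A) U \<and> openin (zariski A) V \<and> P \<in> U \<and> M \<in> V \<and> U \<inter> V = {}"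
    if M: "M \<in> C" for M
    using zariski_separates_min_prime[OF subsetD[OF C(2) M] P nle[OF M]] by metis
  then obtain U V where UV: "\<And>M. M \<in> C \<Longrightarrow> openin (zariski A) (U M) \<and> openin (zariski A) (V M)
      \<and> P \<in> U M \<and> M \<in> V M \<and> U M \<inter> V M = {}"
    by metis
  have "\<exists>\<F>. finite \<F> \<and> \<F> \<subseteq> V ` C \<and> C \<subseteq> \<Union>\<F>"
    by (rule compactinD[OF C(1)]) (use UV in auto)
  then obtain D where D: "finite D" "D \<subseteq> C" "C \<subseteq> (\<Union>M\<in>D. V M)"
    by (metis finite_subset_image)
  (* Including the whole spectrum keeps the intersection inside it when D is empty. *)
  let ?N = "\<Inter>(insert (Spec A) (U ` D))"
  show thesis
  proof (rule that)
    show "openin (zariski A) ?N"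
      using D UV openin_topspace[of "zariski A"]
      by (intro openin_Inter) (auto simp: topspace_zariski)
    show "openin (zariski A) (\<Union>M\<in>D. V M)" using D UV by blast
    show "P \<in> ?N" using D UV P by blast
    show "C \<subseteq> (\<Union>M\<in>D. V M)" by (rule D(3))
    show "?N \<inter> (\<Union>M\<in>D. V M) = {}" using D(2) UV by fastforce
  qed
qed

lemma continuous_map_min_retraction:
  assumes mp: "mp_ring A" and comp: "compact_space (min_zariski A)"
  shows "continuous_map (zariski A) (min_zariski A) (min_retraction A)"
  unfolding continuous_map topspace_zariski topspace_min_zariski
proof (intro conjI allI impI)
  show "min_retraction A ` Spec A \<subseteq> min_primes A" using min_retraction(1)[OF mp] by blast
next
  fix G assume G: "openin (min_zariski A) G"
  define C where "C = min_primes A - G"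
  have "closedin (min_zariski A) C"
    unfolding C_def topspace_min_zariski[symmetric] using G by blast
  then have "compactin (min_zariski A) C" by (rule closedin_compact_space[OF comp])
  then have C: "compactin (zariski A) C" "C \<subseteq> min_primes A"
    by (auto simp: min_zariski_def compactin_subtopology)
  show "openin (zariski A) {P \<in> Spec A. min_retraction A P \<in> G}" (is "openin _ ?G")
  proof (subst openin_subopen, intro ballI)
    fix P assume "P \<in> ?G"
    then have P: "P \<in> Spec A" "min_retraction A P \<in> G" by auto
    have "\<not> M \<subseteq> P" if M: "M \<in> C" for M
    proof
      assume "M \<subseteq> P"
      then have "M = min_retraction A P"
        using mp P(1) M C(2) min_retraction[OF mp P(1)] unfolding mp_ring_def by blast
      then show False using M P(2) by (simp add: C_def)
    qed
    then obtain N W where N: "openin (zariski A) N" "P \<in> N" and W: "C \<subseteq> W" "N \<inter> W = {}"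
      using zariski_separates_compact_min_primes[OF C P(1)] by metis
    have "N \<subseteq> ?G"
    proof
      fix Q assume Q: "Q \<in> N"
      then have QS: "Q \<in> Spec A" using openin_subset[OF N(1)] by (auto simp: topspace_zariski)
      note r = min_retraction[OF mp QS]
      have "min_retraction A Q \<in> N"
        using openin_zariski_downward[OF N(1) Q] r by (auto simp: min_primes_def)
      then show "Q \<in> ?G" using W r(1) QS by (auto simp: C_def)
    qed
    then show "\<exists>T. openin (zariski A) T \<and> P \<in> T \<and> T \<subseteq> ?G" using N by blast
  qed
qed

lemma min_retraction_image:
  assumes "mp_ring A"
  shows "min_retraction A ` Spec A = min_primes A"
proof
  show "min_retraction A ` Spec A \<subseteq> min_primes A"
    using min_retraction(1)[OF assms] by (rule image_subsetI)
  show "min_primes A \<subseteq> min_retraction A ` Spec A"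
  proof
    fix M assume M: "M \<in> min_primes A"
    then have "M \<in> Spec A" by (simp add: min_primes_def)
    then show "M \<in> min_retraction A ` Spec A"
      using min_retraction_min_primes[OF assms M] by (metis imageI)
  qed
qed

theorem theorem6p3:
  fixes A :: "('a, 'b) ring_scheme"
  assumes "mp_ring A"
  shows "continuous_map (zariski A) (min_zariski A) (min_retraction A) \<longleftrightarrow>
    compact_space (min_zariski A) \<and> Hausdorff_space (min_zariski A)"
proof
  assume cont: "continuous_map (zariski A) (min_zariski A) (min_retraction A)"
  interpret cring A using assms by (simp add: mp_ring_def)
  have "compactin (min_zariski A) (min_retraction A ` Spec A)"
    using compact_space_zariski unfolding compact_space_def topspace_zariski
    by (rule image_compactin[OF _ cont])
  then have "compact_space (min_zariski A)"
    by (simp add: compact_space_def topspace_min_zariski min_retraction_image[OF assms])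
  then show "compact_space (min_zariski A) \<and> Hausdorff_space (min_zariski A)"
    using Hausdorff_space_min_zariski by blast
next
  assume "compact_space (min_zariski A) \<and> Hausdorff_space (min_zariski A)"
  then show "continuous_map (zariski A) (min_zariski A) (min_retraction A)"
    using continuous_map_min_retraction[OF assms] by blast
qed

end
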